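(* Let $\varphi\in\Phi$ satisfy $\sup_{y\in[1/c,\,c]}\varphi(y)<+\infty$ for every $c>1$, and suppose $\varphi(0^+)=\lim_{y\to0^+}\varphi(y)=+\infty$. Let $v,w:G\to(0,+\infty)$ be the weights $v(x+iy)=e^{-\varphi(y)}$ and $w(x+iy)=e^{-\varphi^{**}(y)}$. Then $$\bigl(H_{v_0}(G),\|\cdot\|_v\bigr)\equiv\bigl(H_{w_0}(G),\|\cdot\|_w\bigr),$$ that is, $H_{v_0}(G)$ and $H_{w_0}(G)$ are the same set of functions and $\|f\|_v=\|f\|_w$ for every $f$ in it.
   Context: $G=\{x+iy : x\in\mathbb{R},\ y\in(0,+\infty)\}\subset\mathbb{C}$ is the open upper half plane. $\Phi$ is the set of all functions $\varphi:(0,+\infty)\to\mathbb{R}$ (no continuity assumed) for which there exists a real number $a$ with $\inf_{x\in(0,+\infty)}(\varphi(x)-ax)>-\infty$. For $\varphi\in\Phi$ let $M_\varphi=\{(a,b)\in\mathbb{R}^2 : \inf_{t\in(0,+\infty)}(\varphi(t)-at)>b\}$, and define $\varphi^{**}:(0,+\infty)\to\mathbb{R}$ by $\varphi^{**}(x)=\sup_{(a,b)\in M_\varphi}(ax+b)$. For a weight $u:G\to(0,+\infty)$, $H_u(G)$ is the space of all holomorphic functions $f$ on $G$ with $\|f\|_u:=\sup_{z\in G}u(z)|f(z)|<+\infty$. The subspace $H_{u_0}(G)$ consists of all $f\in H_u(G)$ such that for every $\varepsilon>0$ there exists a compact set $K_\varepsilon\subset G$ with $\sup_{z\in G\setminus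 K_\varepsilon}u(z)|f(z)|<\varepsilon$. *)

theory Defs
  imports "HOL-Complex_Analysis.Complex_Analysis"
begin

text \<open>
  Real functions on the open half line and complex functions on the upper half plane are
  represented by total functions; only their values on the half line (respectively half plane)
  are used below. Suprema and infima that may be infinite are taken in \<^typ>\<open>ereal\<close>.
\<close>

definition upper_half_plane :: "complex set" where
  "upper_half_plane = {z. Im z > 0}"

definition Phi :: "(real \<Rightarrow> real) set" where
  "Phi = {\<phi>. \<exists>a::real. (INF x\<in>{0<..}. ereal (\<phi> x - a * x)) > -\<infinity>}"

definition minorants :: "(real \<Rightarrow> real) \<Rightarrow> (real \<times> real) set" where
  "minorants \<phi> = {(a, b). (INF t\<in>{0<..}. ereal (\<phi> t - a * t)) > ereal b}"

text \<open>
  The supremum is the one of the reals. For \<open>\<phi> \<in> Phi\<close> and \<open>x > 0\<close> it is taken over a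
  nonempty set bounded above by \<open>\<phi> x\<close>.
\<close>
definition biconj :: "(real \<Rightarrow> real) \<Rightarrow> real \<Rightarrow> real" where
  "biconj \<phi> x = (SUP (a, b)\<in>minorants \<phi>. a * x + b)"

definition wnorm :: "(complex \<Rightarrow> real) \<Rightarrow> (complex \<Rightarrow> complex) \<Rightarrow> ereal" where
  "wnorm u f = (SUP z\<in>upper_half_plane. ereal (u z * cmod (f z)))"

definition H :: "(complex \<Rightarrow> real) \<Rightarrow> (complex \<Rightarrow> complex) set" where
  "H u = {f. f holomorphic_on upper_half_plane \<and> wnorm u f < \<infinity>}"

definition H0 :: "(complex \<Rightarrow> real) \<Rightarrow> (complex \<Rightarrow> complex) set" where
  "H0 u = {f \<in> H u. \<forall>\<epsilon>::real. \<epsilon> > 0 \<longrightarrow>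
     (\<exists>K. compact K \<and> K \<subseteq> upper_half_plane \<and>
        (SUP z\<in>upper_half_plane - K. ereal (u z * cmod (f z))) < ereal \<epsilon>)}"

end

theory Submission
  imports Defs
begin

text \<open>
  If \<open>v |f| \<le> C\<close>, the three lines theorem makes \<open>log |f|\<close> at height \<open>y\<close> at most every convex
  interpolation of \<open>\<phi> + log C\<close> across \<open>y\<close>, so some affine minorant of \<open>\<phi> + log C\<close> lies above
  it there; hence \<open>w |f| \<le> C\<close>, and the norms agree. The vanishing condition is then transferred by
  multiplying \<open>f\<close> with functions \<open>q\<close> of modulus at most \<open>1\<close> that are tiny on the compact set where
  \<open>v |f|\<close> is not small, so that \<open>f q\<close> has small \<open>v\<close>-norm and thus small \<open>w\<close>-norm:
  \<open>q z = z / (z + iA)\<close> satisfies \<open>|q| \<ge> 1/2\<close> for \<open>|z| \<ge> A\<close>, and \<open>q z = exp (iNz)\<close> satisfies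
  \<open>|q| \<ge> 1/2\<close> near the real axis.
\<close>

section \<open>The three lines theorem on horizontal strips\<close>

lemma norm_plus_i_ge:
  assumes "Im z \<ge> 0"
  shows "cmod (z + \<i>) \<ge> 1"
  using abs_Im_le_cmod[of "z + \<i>"] assms by simp

text \<open>A Phragmen-Lindelof principle: the size of \<open>B\<close> does not reach the
  conclusion, since it only controls \<open>F\<close> on the vertical sides of a rectangle that may
  be taken as wide as needed.\<close>

lemma strip_maximum_modulus:
  fixes F :: "complex \<Rightarrow> complex"
  assumes hol: "F holomorphic_on upper_half_plane"
    and pos: "0 < y1" and z0: "y1 \<le> Im z0" "Im z0 \<le> y2"
    and bounded: "\<And>z. y1 \<le> Im z \<Longrightarrow> Im z \<le> y2 \<Longrightarrow> cmod (F z) \<le> B"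
    and edge1: "\<And>z. Im z = y1 \<Longrightarrow> cmod (F z) \<le> 1"
    and edge2: "\<And>z. Im z = y2 \<Longrightarrow> cmod (F z) \<le> 1"
  shows "cmod (F z0) \<le> 1"
proof (rule ccontr)
  text \<open>Dividing \<open>F ^ n\<close> by \<open>z + \<i>\<close> forces decay along the strip; the loss disappears as \<open>n\<close> grows.\<close>
  have power_bound: "cmod (F z0) ^ n \<le> cmod (z0 + \<i>)" for n
  proof -
    \<comment> \<open>On the vertical sides \<open>cmod (z + \<i>)\<close> is at least
      \<open>R\<close>, so \<open>B ^ n \<le> R\<close> suffices there;
      \<open>\<bar>Re z0\<bar> \<le> R\<close> puts \<open>z0\<close> inside.\<close>
    define R where "R = max (B ^ n) \<bar>Re z0\<bar> + 1"
    define S where "S = cbox (Complex (-R) y1) (Complex R y2)"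
    define g where "g = (\<lambda>z. F z ^ n / (z + \<i>))"
    have R: "R > 0" "B ^ n \<le> R" "\<bar>Re z0\<bar> \<le> R"
      unfolding R_def by linarith+
    have S_iff: "z \<in> S \<longleftrightarrow> -R \<le> Re z \<and> Re z \<le> R \<and> y1 \<le> Im z \<and> Im z \<le> y2" for z
      by (auto simp: S_def in_cbox_complex_iff)
    have S_sub: "S \<subseteq> upper_half_plane"
      using pos by (auto simp: S_iff upper_half_plane_def)
    have "z + \<i> \<noteq> 0" if "z \<in> S" for z
      using norm_plus_i_ge[of z] that pos by (auto simp: S_iff)
    then have hol_g: "g holomorphic_on S"
      unfolding g_def using holomorphic_on_subset[OF hol S_sub] by (intro holomorphic_intros) auto
    have "cmod (g z0) \<le> 1"
    proof (rule maximum_modulus_frontier[of g S])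
      show "g holomorphic_on interior S"
        using hol_g interior_subset holomorphic_on_subset by blast
      show "continuous_on (closure S) g"
        using holomorphic_on_imp_continuous_on[OF hol_g] by (simp add: S_def)
      show "bounded S" by (simp add: S_def)
      show "z0 \<in> S" using R(3) z0 by (auto simp: S_iff)
    next
      fix z assume "z \<in> frontier S"
      then have z: "z \<in> S" and nz: "z \<notin> box (Complex (-R) y1) (Complex R y2)"
        by (auto simp: S_def frontier_def interior_cbox)
      have im: "Im z \<ge> 0" using z pos by (auto simp: S_iff)
      have pos': "cmod (z + \<i>) > 0" using norm_plus_i_ge[OF im] by linarith
      have "cmod (F z) ^ n \<le> cmod (z + \<i>)"
      proof (cases "Im z = y1 \<or> Im z = y2")
        case True
        then have "cmod (F z) ^ n \<le> 1"
          using edge1 edge2 by (intro power_le_one) auto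
        then show ?thesis using norm_plus_i_ge[OF im] by linarith
      next
        case False
        then have "\<bar>Re z\<bar> = R"
          using z nz R(1) by (auto simp: S_iff in_box_complex_iff)
        then have "R \<le> cmod (z + \<i>)" using abs_Re_le_cmod[of "z + \<i>"] by simp
        moreover have "cmod (F z) ^ n \<le> B ^ n"
          using z bounded by (intro power_mono) (auto simp: S_iff)
        ultimately show ?thesis using R(2) by linarith
      qed
      then show "cmod (g z) \<le> 1"
        using pos' by (simp add: g_def norm_divide norm_power)
    qed
    moreover have "cmod (z0 + \<i>) > 0" using norm_plus_i_ge[of z0] z0 pos by linarith
    ultimately show ?thesis by (simp add: g_def norm_divide norm_power)
  qed
  assume "\<not> cmod (F z0) \<le> 1"
  then obtain n where "cmod (z0 + \<i>) < cmod (F z0) ^ n"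
    using real_arch_pow[of "cmod (F z0)" "cmod (z0 + \<i>)"] by auto
  with power_bound[of n] show False by simp
qed

text \<open>The exponential of a suitable affine function of \<open>z\<close> has as modulus the
  exponential of an affine function of \<open>Im z\<close>, so one such factor normalises both edge
  bounds to 1.\<close>

lemma three_lines:
  fixes f :: "complex \<Rightarrow> complex"
  assumes hol: "f holomorphic_on upper_half_plane"
    and pos: "0 < y1" and z0: "y1 < Im z0" "Im z0 < y2"
    and bounded: "\<And>z. y1 \<le> Im z \<Longrightarrow> Im z \<le> y2 \<Longrightarrow> cmod (f z) \<le> B"
    and edge1: "\<And>z. Im z = y1 \<Longrightarrow> cmod (f z) \<le> exp a"
    and edge2: "\<And>z. Im z = y2 \<Longrightarrow> cmod (f z) \<le> exp b"
  shows "cmod (f z0) \<le> exp (a + (b - a) / (y2 - y1) * (Im z0 - y1))"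
proof -
  define k where "k = (b - a) / (y2 - y1)"
  \<comment> \<open>\<open>l\<close> is the line with value \<open>a\<close> at \<open>y1\<close>
    and \<open>b\<close> at \<open>y2\<close>; the factor in \<open>F\<close> has modulus
    \<open>exp (- l (Im z))\<close>.\<close>
  define l where "l = (\<lambda>y. a + k * (y - y1))"
  define F where "F = (\<lambda>z. f z * exp (\<i> * of_real k * z - of_real (a - k * y1)))"
  have norm_F: "cmod (F z) = cmod (f z) * exp (- l (Im z))" for z
    by (simp add: F_def l_def norm_mult algebra_simps)
  have norm_F_le_1: "cmod (F z) \<le> 1 \<longleftrightarrow> cmod (f z) \<le> exp (l (Im z))" for z
    by (simp add: norm_F exp_minus pos_divide_le_eq flip: divide_inverse)
  have "cmod (F z0) \<le> 1"
  proof (rule strip_maximum_modulus[OF _ pos, where F = F and ?z0.0 = z0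
        and ?y2.0 = y2 and B = "B * exp (\<bar>a\<bar> + \<bar>k\<bar> * (y2 - y1))"])
    show "F holomorphic_on upper_half_plane"
      unfolding F_def using hol by (intro holomorphic_intros)
    show "cmod (F z) \<le> B * exp (\<bar>a\<bar> + \<bar>k\<bar> * (y2 - y1))" if "y1 \<le> Im z" "Im z \<le> y2" for z
    proof -
      have "- (k * (Im z - y1)) \<le> \<bar>k\<bar> * (y2 - y1)"
        using that by (intro order_trans[OF abs_ge_minus_self]) (auto simp: abs_mult intro: mult_left_mono)
      then have "- l (Im z) \<le> \<bar>a\<bar> + \<bar>k\<bar> * (y2 - y1)"
        unfolding l_def by linarith
      moreover have "0 \<le> B" using bounded[OF that] norm_ge_zero order_trans by blast
      ultimately show ?thesis
        unfolding norm_F using bounded[OF that] by (intro mult_mono) auto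
    qed
    show "cmod (F z) \<le> 1" if "Im z = y1" for z
      using edge1[OF that] that by (simp add: norm_F_le_1 l_def)
    have "l y2 = b" using z0 by (simp add: l_def k_def)
    then show "cmod (F z) \<le> 1" if "Im z = y2" for z
      using edge2[OF that] that by (simp add: norm_F_le_1)
  qed (use z0 in auto)
  then show ?thesis
    by (simp only: norm_F_le_1 l_def k_def)
qed

section \<open>Affine minorants and the biconjugate\<close>

lemma minorants_memI:
  assumes "b < b'" and "\<And>t. t > 0 \<Longrightarrow> a * t + b' \<le> \<phi> t"
  shows "(a, b) \<in> minorants \<phi>"
proof -
  have "ereal b' \<le> (INF t\<in>{0<..}. ereal (\<phi> t - a * t))"
  proof (rule INF_greatest)
    fix t :: real assume "t \<in> {0<..}"
    then show "ereal b' \<le> ereal (\<phi> t - a * t)" using assms(2)[of t] by simp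
  qed
  moreover have "ereal b < ereal b'" using assms(1) by simp
  ultimately have "ereal b < (INF t\<in>{0<..}. ereal (\<phi> t - a * t))" by (rule order.strict_trans2[rotated])
  then show ?thesis by (simp add: minorants_def)
qed

lemma minorants_le:
  assumes "(a, b) \<in> minorants \<phi>" "t > 0"
  shows "a * t + b \<le> \<phi> t"
  using assms less_INF_D[of "ereal b" "\<lambda>t. ereal (\<phi> t - a * t)" "{0<..}" t]
  by (auto simp: minorants_def)

text \<open>Needed because \<open>biconj\<close> is a real supremum, which says nothing on an empty
  set.\<close>

lemma minorants_nonempty:
  assumes "\<phi> \<in> Phi"
  shows "minorants \<phi> \<noteq> {}"
proof -
  obtain a where "(INF x\<in>{0<..}. ereal (\<phi> x - a * x)) > -\<infinity>"
    using assms by (auto simp: Phi_def)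
  then obtain b where "ereal b < (INF x\<in>{0<..}. ereal (\<phi> x - a * x))"
    using ereal_dense2 by blast
  then show ?thesis by (auto simp: minorants_def)
qed

lemma biconj_le:
  assumes "\<phi> \<in> Phi" "y > 0"
  shows "biconj \<phi> y \<le> \<phi> y"
  unfolding biconj_def
  using minorants_nonempty[OF assms(1)] minorants_le assms(2) by (intro cSUP_least) auto

lemma biconj_ge:
  assumes "y > 0" and line: "\<And>t. t > 0 \<Longrightarrow> s + k * (t - y) \<le> \<phi> t"
  shows "s \<le> biconj \<phi> y"
proof (rule field_le_epsilon)
  fix e :: real assume "e > 0"
  \<comment> \<open>Membership in \<open>minorants\<close> demands a strict inequality, so the line
    through \<open>(y, s)\<close> is lowered by \<open>e\<close>.\<close>
  have "(k, s - k * y - e) \<in> minorants \<phi>"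
    by (rule minorants_memI[of _ "s - k * y"]) (use \<open>e > 0\<close> line in \<open>auto simp: algebra_simps\<close>)
  moreover have "bdd_above ((\<lambda>(a, b). a * y + b) ` minorants \<phi>)"
    using minorants_le assms(1) by (intro bdd_aboveI[of _ "\<phi> y"]) auto
  ultimately have "(\<lambda>(a, b). a * y + b) (k, s - k * y - e) \<le> biconj \<phi> y"
    unfolding biconj_def by (intro cSUP_upper) auto
  then show "s \<le> biconj \<phi> y + e" by simp
qed

text \<open>A separation argument in the plane: a point below the graph and below all chords across
  it carries a line that stays below the graph.\<close>

lemma biconj_ge_of_interpolation:
  assumes "y > 0" and "s \<le> \<phi> y"
    and interp: "\<And>y1 y2. 0 < y1 \<Longrightarrow> y1 < y \<Longrightarrow> y < y2 \<Longrightarrow>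
      s \<le> \<phi> y1 + (\<phi> y2 - \<phi> y1) / (y2 - y1) * (y - y1)"
  shows "s \<le> biconj \<phi> y"
proof -
  \<comment> \<open>\<open>L t\<close> and \<open>U t\<close> are the slopes of the segments joining
    \<open>(y, s)\<close> to the graph point over \<open>t\<close>, for \<open>t\<close> to the left
    and to the right of \<open>y\<close>.\<close>
  define L where "L = (\<lambda>t. (s - \<phi> t) / (y - t))"
  define U where "U = (\<lambda>t. (\<phi> t - s) / (t - y))"
  have LU: "L y1 \<le> U y2" if "0 < y1" "y1 < y" "y < y2" for y1 y2
  proof -
    have "(s - \<phi> y1) * (y2 - y1) \<le> (\<phi> y2 - \<phi> y1) * (y - y1)"
      using interp[OF that] that by (simp add: field_simps)
    then have "(s - \<phi> y1) * (y2 - y) \<le> (\<phi> y2 - s) * (y - y1)"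
      by (simp add: algebra_simps)
    then show ?thesis
      using that by (simp add: L_def U_def divide_le_eq le_divide_eq mult.commute)
  qed
  \<comment> \<open>Any slope between all \<open>L\<close> and all \<open>U\<close> gives a line
    below \<open>\<phi>\<close>; the supremum of \<open>L\<close> is finite because
    \<open>U (y + 1)\<close> bounds it.\<close>
  define k where "k = (SUP t\<in>{0<..<y}. L t)"
  have ne: "{0<..<y} \<noteq> {}" using assms(1) by simp
  have bdd: "bdd_above (L ` {0<..<y})"
    using LU[of _ "y + 1"] by (intro bdd_aboveI[of _ "U (y + 1)"]) auto
  show ?thesis
  proof (rule biconj_ge[OF assms(1)])
    fix t :: real assume "t > 0"
    consider "t < y" | "t = y" | "t > y" by linarith
    then show "s + k * (t - y) \<le> \<phi> t"
    proof cases
      case 1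
      then have "L t \<le> k" unfolding k_def using \<open>t > 0\<close> bdd by (intro cSUP_upper) auto
      then show ?thesis using 1 by (simp add: L_def divide_le_eq algebra_simps)
    next
      case 2
      then show ?thesis using assms(2) by simp
    next
      case 3
      then have "k \<le> U t" unfolding k_def using ne LU by (intro cSUP_least) auto
      then show ?thesis using 3 by (simp add: U_def le_divide_eq algebra_simps)
    qed
  qed
qed

text \<open>The three lines theorem puts \<open>ln (cmod (f z0)) - ln C\<close> below every chord of
  \<open>\<phi>\<close> across \<open>Im z0\<close>; \<open>loc\<close> supplies the a priori bound
  on each closed strip.\<close>

lemma norm_le_exp_biconj:
  fixes f :: "complex \<Rightarrow> complex"
  assumes hol: "f holomorphic_on upper_half_plane"
    and loc: "\<And>y1 y2. 0 < y1 \<Longrightarrow> \<exists>B. \<forall>y\<in>{y1..y2}. \<phi> y \<le> B"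
    and "C > 0"
    and le: "\<And>z. z \<in> upper_half_plane \<Longrightarrow> cmod (f z) \<le> C * exp (\<phi> (Im z))"
    and z0: "z0 \<in> upper_half_plane"
  shows "cmod (f z0) \<le> C * exp (biconj \<phi> (Im z0))"
proof (cases "f z0 = 0")
  case True
  then show ?thesis using \<open>C > 0\<close> by simp
next
  case False
  define c where "c = ln C"
  have C: "C = exp c" using \<open>C > 0\<close> by (simp add: c_def)
  define s where "s = ln (cmod (f z0)) - c"
  have exp_s: "cmod (f z0) = exp (c + s)" using False by (simp add: s_def)
  have le': "cmod (f z) \<le> exp (c + \<phi> (Im z))" if "Im z > 0" for z
    using le[of z] that by (simp add: C exp_add upper_half_plane_def)
  have pos: "Im z0 > 0" using z0 by (simp add: upper_half_plane_def)
  have "s \<le> biconj \<phi> (Im z0)"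
  proof (rule biconj_ge_of_interpolation[OF pos])
    show "s \<le> \<phi> (Im z0)" using le'[OF pos] exp_s by simp
    fix y1 y2 assume y: "0 < y1" "y1 < Im z0" "Im z0 < y2"
    obtain B where B: "\<And>y. y \<in> {y1..y2} \<Longrightarrow> \<phi> y \<le> B" using loc[OF y(1)] by blast
    have "cmod (f z0) \<le> exp ((c + \<phi> y1) + ((c + \<phi> y2) - (c + \<phi> y1)) / (y2 - y1) * (Im z0 - y1))"
    proof (rule three_lines[OF hol y, where B = "exp (c + B)"])
      fix z assume z: "y1 \<le> Im z" "Im z \<le> y2"
      then have "exp (c + \<phi> (Im z)) \<le> exp (c + B)" using B by simp
      then show "cmod (f z) \<le> exp (c + B)" using le'[of z] z y(1) by linarith
    qed (use le' y in force)+
    \<comment> \<open>Adding \<open>c\<close> to both end values raises the interpolant by exactly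
      \<open>c\<close>, which cancels.\<close>
    then show "s \<le> \<phi> y1 + (\<phi> y2 - \<phi> y1) / (y2 - y1) * (Im z0 - y1)"
      by (simp add: exp_s)
  qed
  then show ?thesis by (simp add: exp_s C exp_add)
qed

section \<open>Weighted norms and the vanishing condition\<close>

lemma wnorm_le_iff:
  "wnorm u f \<le> ereal C \<longleftrightarrow> (\<forall>z\<in>upper_half_plane. u z * cmod (f z) \<le> C)"
  by (simp add: wnorm_def SUP_le_iff)

lemma wnorm_finiteD:
  assumes "wnorm u f < \<infinity>"
  obtains C where "C > 0" "\<And>z. z \<in> upper_half_plane \<Longrightarrow> u z * cmod (f z) \<le> C"
proof -
  obtain C where "wnorm u f \<le> ereal C"
    using assms less_ereal.simps less_imp_le by (metis ereal_dense2)
  then have "\<forall>z\<in>upper_half_plane. u z * cmod (f z) \<le> C" by (simp only: wnorm_le_iff)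
  then show ?thesis using that[of "max C 1"] by fastforce
qed

lemma weighted_SUP_mono:
  fixes v w :: "complex \<Rightarrow> real"
  assumes "\<And>z. z \<in> A \<Longrightarrow> v z \<le> w z"
  shows "(SUP z\<in>A. ereal (v z * cmod (f z))) \<le> (SUP z\<in>A. ereal (w z * cmod (f z)))"
proof (rule SUP_mono)
  fix z assume "z \<in> A"
  then show "\<exists>z'\<in>A. ereal (v z * cmod (f z)) \<le> ereal (w z' * cmod (f z'))"
    using assms by (intro bexI[of _ z]) (auto intro: mult_right_mono)
qed

lemma wnorm_mono:
  assumes "\<And>z. z \<in> upper_half_plane \<Longrightarrow> v z \<le> w z"
  shows "wnorm v f \<le> wnorm w f"
  unfolding wnorm_def using assms by (rule weighted_SUP_mono)

text \<open>The compact set found for \<open>w\<close> serves for \<open>v\<close> as well.\<close>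

lemma H0_antimono:
  assumes le: "\<And>z. z \<in> upper_half_plane \<Longrightarrow> v z \<le> w z"
  shows "H0 w \<subseteq> H0 v"
proof
  fix f assume f: "f \<in> H0 w"
  have sup_le: "(SUP z\<in>upper_half_plane - K. ereal (v z * cmod (f z)))
      \<le> (SUP z\<in>upper_half_plane - K. ereal (w z * cmod (f z)))" for K
    using le by (intro weighted_SUP_mono) auto
  have "f \<in> H v"
    using f wnorm_mono[of v w f, OF le] by (auto simp: H0_def H_def)
  then show "f \<in> H0 v"
    using f sup_le unfolding H0_def by (blast intro: le_less_trans)
qed

text \<open>\<open>R\<close> and \<open>d\<close> calibrate the rational and the exponential
  multiplier, so that each is small on \<open>K\<close>.\<close>

lemma compact_subset_upper_half_plane:
  assumes "compact K" "K \<subseteq> upper_half_plane"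
  obtains d R where "d > 0" "\<forall>z\<in>K. d \<le> Im z" "R > 0" "\<forall>z\<in>K. cmod z \<le> R"
proof -
  obtain R where R: "R > 0" "\<And>z. z \<in> K \<Longrightarrow> cmod z \<le> R"
    using compact_imp_bounded[OF assms(1)] by (auto simp: bounded_pos)
  have "\<exists>d>0. \<forall>z\<in>K. d \<le> Im z"
  proof (cases "K = {}")
    case True
    then show ?thesis by (auto intro: exI[of _ 1])
  next
    case False
    moreover have "continuous_on K Im" by (intro continuous_intros)
    ultimately obtain z where "z \<in> K" "\<forall>t\<in>K. Im z \<le> Im t"
      using continuous_attains_inf[OF assms(1), of Im] by blast
    then show ?thesis using assms(2) by (auto simp: upper_half_plane_def intro!: exI[of _ "Im z"])
  qed
  then show ?thesis using that R by blast
qed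

text \<open>\<open>transfer\<close> is assumed for all \<open>g\<close> so that it applies to
  \<open>f\<close> with bound \<open>C\<close> and to the products \<open>f * q\<close> with a much
  smaller bound.\<close>

lemma H0_transfer:
  fixes v w :: "complex \<Rightarrow> real"
  assumes w_pos: "\<And>z. z \<in> upper_half_plane \<Longrightarrow> 0 < w z"
    and transfer: "\<And>g C z. g holomorphic_on upper_half_plane \<Longrightarrow> C > 0 \<Longrightarrow>
      (\<And>z. z \<in> upper_half_plane \<Longrightarrow> v z * cmod (g z) \<le> C) \<Longrightarrow>
      z \<in> upper_half_plane \<Longrightarrow> w z * cmod (g z) \<le> C"
  shows "H0 v \<subseteq> H0 w"
proof
  fix f assume f: "f \<in> H0 v"
  then have hol: "f holomorphic_on upper_half_plane" and fin: "wnorm v f < \<infinity>"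
    by (auto simp: H0_def H_def)
  obtain C where C: "C > 0" "\<And>z. z \<in> upper_half_plane \<Longrightarrow> v z * cmod (f z) \<le> C"
    using wnorm_finiteD[OF fin] by blast
  have "wnorm w f \<le> ereal C"
    unfolding wnorm_le_iff using transfer[OF hol C] by blast
  then have "f \<in> H w" using hol by (auto simp: H_def)
  moreover have "\<exists>K. compact K \<and> K \<subseteq> upper_half_plane \<and>
      (SUP z\<in>upper_half_plane - K. ereal (w z * cmod (f z))) < ereal \<epsilon>" if "\<epsilon> > 0" for \<epsilon> :: real
  proof -
    \<comment> \<open>Dividing by \<open>cmod (q z) \<ge> 1 / 2\<close> doubles \<open>e\<close>; a
      further factor 2 keeps the final inequality strict.\<close>
    define e where "e = \<epsilon> / 4"
    have e: "e > 0" "2 * e < \<epsilon>" using that by (auto simp: e_def)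
    obtain K where K: "compact K" "K \<subseteq> upper_half_plane"
      and sup: "(SUP z\<in>upper_half_plane - K. ereal (v z * cmod (f z))) < ereal e"
      using f e(1) unfolding H0_def by blast
    have off_K: "v z * cmod (f z) \<le> e" if "z \<in> upper_half_plane" "z \<notin> K" for z
    proof -
      have "ereal (v z * cmod (f z)) \<le> (SUP z\<in>upper_half_plane - K. ereal (v z * cmod (f z)))"
        using that by (intro SUP_upper) auto
      then have "ereal (v z * cmod (f z)) < ereal e" using sup by (rule order.strict_trans1)
      then show ?thesis by simp
    qed
    obtain d R where d: "d > 0" "\<And>z. z \<in> K \<Longrightarrow> d \<le> Im z"
      and R: "R > 0" "\<And>z. z \<in> K \<Longrightarrow> cmod z \<le> R"
      using compact_subset_upper_half_plane[OF K] by metis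
    \<comment> \<open>The product \<open>f * q\<close> has \<open>v\<close>-norm at most
      \<open>e\<close>: on \<open>K\<close> the factor \<open>q\<close> is small, off
      \<open>K\<close> already \<open>v z * cmod (f z) \<le> e\<close>.\<close>
    have multiplier: "w z * cmod (f z) \<le> 2 * e"
      if q: "q holomorphic_on upper_half_plane" "\<And>z. z \<in> upper_half_plane \<Longrightarrow> cmod (q z) \<le> 1"
        "\<And>z. z \<in> K \<Longrightarrow> C * cmod (q z) \<le> e"
      and z: "z \<in> upper_half_plane" "1 / 2 \<le> cmod (q z)" for q z
    proof -
      have "w z * cmod (f z * q z) \<le> e"
      proof (rule transfer[OF _ e(1) _ z(1)])
        show "(\<lambda>z. f z * q z) holomorphic_on upper_half_plane"
          using hol q(1) by (intro holomorphic_intros)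
        fix z assume z: "z \<in> upper_half_plane"
        show "v z * cmod (f z * q z) \<le> e"
        proof (cases "z \<in> K")
          case True
          have "v z * cmod (f z) * cmod (q z) \<le> C * cmod (q z)"
            using C(2)[OF z] by (intro mult_right_mono) auto
          then show ?thesis using q(3)[OF True] by (simp add: norm_mult mult.assoc)
        next
          case False
          have "v z * cmod (f z) * cmod (q z) \<le> e * 1"
            using off_K[OF z False] q(2)[OF z] e(1) by (intro mult_mono) auto
          then show ?thesis by (simp add: norm_mult mult.assoc)
        qed
      qed
      moreover have "w z * cmod (f z) * (1 / 2) \<le> w z * cmod (f z) * cmod (q z)"
        using z w_pos[OF z(1)] by (intro mult_left_mono) auto
      ultimately show ?thesis by (simp add: norm_mult mult.assoc)
    qed
    \<comment> \<open>On \<open>K\<close> the quotient is at most \<open>R / A\<close>, which equals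
      \<open>e / C\<close>.\<close>
    define A where "A = R * C / e"
    have A: "A > 0" using R(1) C(1) e(1) by (simp add: A_def)
    have norm_shift: "cmod z \<le> cmod (z + \<i> * of_real A)" "A \<le> cmod (z + \<i> * of_real A)"
      if "z \<in> upper_half_plane" for z
    proof -
      have "0 < Im z" using that by (simp add: upper_half_plane_def)
      then show "cmod z \<le> cmod (z + \<i> * of_real A)"
        using A by (auto simp: cmod_def intro!: power_mono)
      show "A \<le> cmod (z + \<i> * of_real A)"
        using abs_Im_le_cmod[of "z + \<i> * of_real A"] \<open>0 < Im z\<close> A by simp
    qed
    have far: "w z * cmod (f z) \<le> 2 * e" if z: "z \<in> upper_half_plane" "A \<le> cmod z" for z
    proof (rule multiplier[of "\<lambda>z. z / (z + \<i> * of_real A)", OF _ _ _ z(1)])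
      have "z + \<i> * of_real A \<noteq> 0" if "z \<in> upper_half_plane" for z
        using norm_shift(2)[OF that] A by auto
      then show "(\<lambda>z. z / (z + \<i> * of_real A)) holomorphic_on upper_half_plane"
        by (intro holomorphic_intros) auto
      show "cmod (z / (z + \<i> * of_real A)) \<le> 1" if "z \<in> upper_half_plane" for z
        using norm_shift[OF that] A by (simp add: norm_divide divide_le_eq_1)
      show "C * cmod (z / (z + \<i> * of_real A)) \<le> e" if "z \<in> K" for z
      proof -
        have "cmod (z / (z + \<i> * of_real A)) \<le> R / A"
          unfolding norm_divide using norm_shift(2)[of z] that K(2) R A by (intro frac_le) auto
        then have "C * cmod (z / (z + \<i> * of_real A)) \<le> C * (R / A)"
          using C(1) by (intro mult_left_mono) auto
        also have "\<dots> = e" using C(1) R(1) e(1) by (simp add: A_def)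
        finally show ?thesis .
      qed
      \<comment> \<open>For \<open>A \<le> cmod z\<close> the right side is at most
        \<open>2 * cmod z\<close>.\<close>
      have "cmod (z + \<i> * of_real A) \<le> cmod z + A"
        using norm_triangle_ineq[of z "\<i> * of_real A"] A by (simp add: norm_mult)
      moreover have "0 < cmod (z + \<i> * of_real A)" using norm_shift(2)[OF z(1)] A by linarith
      ultimately show "1 / 2 \<le> cmod (z / (z + \<i> * of_real A))"
        using z(2) unfolding norm_divide by (subst pos_le_divide_eq) auto
    qed
    \<comment> \<open>\<open>N * d \<ge> ln (C / e)\<close> brings the exponential down to
      \<open>e / C\<close> on \<open>K\<close>; the maximum with 1 keeps \<open>N\<close> positive
      when \<open>C \<le> e\<close>.\<close>
    define N where "N = max 1 (ln (C / e) / d)"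
    have N: "N > 0" "ln (C / e) \<le> N * d"
      using d(1) by (auto simp: N_def max_def field_simps)
    have near: "w z * cmod (f z) \<le> 2 * e" if z: "z \<in> upper_half_plane" "Im z \<le> ln 2 / N" for z
    proof (rule multiplier[of "\<lambda>z. exp (\<i> * of_real N * z)", OF _ _ _ z(1)])
      show "(\<lambda>z. exp (\<i> * of_real N * z)) holomorphic_on upper_half_plane"
        by (intro holomorphic_intros)
      show "cmod (exp (\<i> * of_real N * z)) \<le> 1" if "z \<in> upper_half_plane" for z
        using that N(1) by (simp add: upper_half_plane_def)
      show "C * cmod (exp (\<i> * of_real N * z)) \<le> e" if "z \<in> K" for z
      proof -
        have "N * d \<le> N * Im z" using d(2)[OF that] N(1) by simp
        then have "C * exp (- (N * Im z)) \<le> C * exp (- ln (C / e))"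
          using N(2) C(1) by (intro mult_left_mono) auto
        also have "\<dots> = e" using C(1) e(1) by (simp add: exp_minus)
        finally show ?thesis by simp
      qed
      have "N * Im z \<le> ln 2" using z(2) N(1) by (simp add: field_simps)
      then have "exp (- ln 2) \<le> exp (- (N * Im z))" by simp
      then show "1 / 2 \<le> cmod (exp (\<i> * of_real N * z))" by (simp add: exp_minus)
    qed
    \<comment> \<open>Every point of the half plane outside \<open>K'\<close> falls under
      \<open>far\<close> or \<open>near\<close>.\<close>
    define K' where "K' = cball 0 A \<inter> {z. ln 2 / N \<le> Im z}"
    have "compact K'"
      unfolding K'_def by (intro compact_Int_closed closed_halfspace_Im_ge) auto
    moreover have "K' \<subseteq> upper_half_plane"
    proof
      fix z assume "z \<in> K'"
      moreover have "ln 2 / N > 0" using N(1) by simp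
      ultimately show "z \<in> upper_half_plane"
        unfolding K'_def upper_half_plane_def by fastforce
    qed
    moreover have "(SUP z\<in>upper_half_plane - K'. ereal (w z * cmod (f z))) \<le> ereal (2 * e)"
    proof (rule SUP_least)
      fix z assume "z \<in> upper_half_plane - K'"
      then show "ereal (w z * cmod (f z)) \<le> ereal (2 * e)"
        using far[of z] near[of z] by (auto simp: K'_def)
    qed
    moreover have "ereal (2 * e) < ereal \<epsilon>" using e(2) by simp
    ultimately show ?thesis by (meson order.strict_trans1)
  qed
  ultimately show "f \<in> H0 w" by (auto simp: H0_def)
qed

section \<open>Equality of the spaces and of the norms\<close>

theorem theorem6p2:
  fixes \<phi> :: "real \<Rightarrow> real" and v w :: "complex \<Rightarrow> real"
  assumes "\<phi> \<in> Phi"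
    and "\<And>c::real. c > 1 \<Longrightarrow> (SUP y\<in>{1/c..c}. ereal (\<phi> y)) < \<infinity>"
    and "filterlim \<phi> at_top (at_right 0)"
    and "\<And>z. z \<in> upper_half_plane \<Longrightarrow> v z = exp (- \<phi> (Im z))"
    and "\<And>z. z \<in> upper_half_plane \<Longrightarrow> w z = exp (- biconj \<phi> (Im z))"
  shows "H0 v = H0 w \<and> (\<forall>f\<in>H0 v. wnorm v f = wnorm w f)"
proof -
  have loc: "\<exists>B. \<forall>y\<in>{y1..y2}. \<phi> y \<le> B" if "0 < y1" for y1 y2
  proof -
    \<comment> \<open>Chosen so that \<open>{y1..y2}\<close> lies in \<open>{1/c..c}\<close>; the 2
      ensures \<open>c > 1\<close>.\<close>
    define c where "c = max 2 (max y2 (1 / y1))"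
    have c: "c > 1" "y2 \<le> c" "1 / y1 \<le> c" by (auto simp: c_def)
    have "1 / c \<le> y1" using c that by (simp add: field_simps)
    moreover obtain B where "(SUP y\<in>{1/c..c}. ereal (\<phi> y)) < ereal B"
      using assms(2)[OF c(1)] ereal_dense2 by blast
    then have "\<phi> y \<le> B" if "y \<in> {1/c..c}" for y
      using SUP_lessD[of "\<lambda>y. ereal (\<phi> y)" "{1/c..c}" "ereal B" y] that by simp
    ultimately show ?thesis using c(2) by (intro exI[of _ B]) auto
  qed
  have le: "v z \<le> w z" if "z \<in> upper_half_plane" for z
    using biconj_le[OF assms(1), of "Im z"] that assms(4,5) by (simp add: upper_half_plane_def)
  have transfer: "w z * cmod (g z) \<le> C"
    if "g holomorphic_on upper_half_plane" "C > 0"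
      and "\<And>z. z \<in> upper_half_plane \<Longrightarrow> v z * cmod (g z) \<le> C" and "z \<in> upper_half_plane" for g C z
  proof -
    have "cmod (g z) \<le> C * exp (biconj \<phi> (Im z))"
      by (rule norm_le_exp_biconj[OF that(1) loc that(2) _ that(4)])
        (use that(3) assms(4) in \<open>auto simp: exp_minus field_simps\<close>)
    then have "w z * cmod (g z) \<le> exp (- biconj \<phi> (Im z)) * (C * exp (biconj \<phi> (Im z)))"
      using assms(5)[OF that(4)] by simp
    also have "\<dots> = C" by (simp add: exp_minus)
    finally show ?thesis .
  qed
  have "H0 v \<subseteq> H0 w"
    by (rule H0_transfer) (use assms(4,5) transfer in auto)
  moreover have "H0 w \<subseteq> H0 v" by (rule H0_antimono[OF le])
  moreover have "wnorm v f = wnorm w f" if "f \<in> H0 v" for f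
  proof (rule antisym)
    show "wnorm v f \<le> wnorm w f" by (rule wnorm_mono[OF le])
    have hol: "f holomorphic_on upper_half_plane" using that by (simp add: H0_def H_def)
    show "wnorm w f \<le> wnorm v f"
    \<comment> \<open>\<open>transfer\<close> requires a positive constant, while the norm of the
      zero function is 0; hence the norm is approached from above.\<close>
    proof (rule dense_ge)
      fix x assume x: "wnorm v f < x"
      \<comment> \<open>Evaluation at the sample point \<open>\<i>\<close> shows that the norm is
        nonnegative, hence \<open>x\<close> positive.\<close>
      have "ereal (v \<i> * cmod (f \<i>)) \<le> wnorm v f"
        unfolding wnorm_def by (rule SUP_upper) (simp add: upper_half_plane_def)
      moreover have "0 \<le> v \<i> * cmod (f \<i>)"
        using assms(4)[of \<i>] by (simp add: upper_half_plane_def)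
      ultimately have "0 < x" using x by (metis ereal_less_eq(5) order.strict_trans1)
      show "wnorm w f \<le> x"
      proof (cases x)
        case (real C)
        then have "\<forall>z\<in>upper_half_plane. v z * cmod (f z) \<le> C"
          using x by (simp flip: wnorm_le_iff)
        then show ?thesis
          using transfer[OF hol, of C] \<open>0 < x\<close> real by (auto simp: wnorm_le_iff)
      qed (use \<open>0 < x\<close> in auto)
    qed
  qed
  ultimately show ?thesis by blast
qed

end
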